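(* Let $X$ be a nonempty finite set and let $d:\mathbb{A}(X)\times\mathbb{A}(X)\to[0,\infty)$ be a semimetric. Then $d$ satisfies Axioms 1–4 below if and only if $d=D$, where $D(\succsim,\trianglerighteq):=\sum_{S\subseteq X}\left|M(S,\succsim)\triangle M(S,\trianglerighteq)\right|$ is the top-difference semimetric. Axiom 1: for all $\succsim,\succsim_0,\trianglerighteq\in\mathbb{A}(X)$ such that $\succsim_0$ is in-between $\succsim$ and $\trianglerighteq$, $d(\succsim,\trianglerighteq)=d(\succsim,\succsim_0)+d(\succsim_0,\trianglerighteq)$. Axiom 2: $d(\succsim_{ab},\succsim_{ab}^{+})=1$ for all distinct $a,b\in X$. Axiom 3: for all $\succsim\in\mathbb{A}(X)$ and distinct $a,b\in X$: if neither $a\succ b$ nor $b\succ a$ and $\succsim\oplus(a,b)$ is defined, then $d(\succsim,\succsim\oplus(a,b))=2^{N(b,\succsim)-1}d(\succsim_{ab},\succsim_{ab}^{+})$; and if $a\succ b$, then $d(\succsim,\succsim\ominus(a,b))=2^{N(b,\succsim)}d(\succsim_{ab},\succsim_{ab}^{+})$. Axiom 4: for all $\succsim,\trianglerighteq\in\mathbb{A}(X)$ with $\succ=\vartriangleright$, $d(\succsim,\trianglerighteq)=0$.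
   Context: A binary relation on $X$ is a nonempty subset $R\subseteq X\times X$; write $x\,R\,y$ for $(x,y)\in R$. Its asymmetric part $R^>$: $x\,R^>\,y$ iff $x\,R\,y$ and not $y\,R\,x$; its symmetric part is $R\setminus R^>$. $\mathrm{Inc}(R)$ is the set of $(x,y)\in X\times X$ with neither $x\,R\,y$ nor $y\,R\,x$. $R$ is acyclic if there are no pairwise distinct $z_1,\dots,z_k$ with $z_1\,R^>\,z_2\cdots R^>\,z_k\,R^>\,z_1$. An acyclic order is a reflexive acyclic relation; $\mathbb{A}(X)$ is the set of acyclic orders on $X$. For $\succsim$ (resp. $\trianglerighteq$) in $\mathbb{A}(X)$, $\succ$ (resp. $\vartriangleright$) is its asymmetric part and $\sim$ its symmetric part. For $S\subseteq X$, $M(S,R):=\{x\in S:\text{there is no }y\in S\text{ with }y\,R^>\,x\}$. Perturbations: for $\succsim\in\mathbb{A}(X)$ and $a\neq b$: if neither $a\succ b$ nor $b\succ a$, let $R:=\succsim\cup\{(a,b)\}$ if $(a,b)\in\mathrm{Inc}(\succsim)$ and $R:=\succsim\setminus\{(b,a)\}$ if $a\sim b$; if $R$ is acyclic, $\succsim\oplus(a,b):=R$ (otherwise undefined). If $a\succ b$, $\succsim\ominus(a,b):=\succsim\setminus\{(a,b)\}$. We write $\succsim\,\rightarrow\,\succsim_0\,\twoheadrightarrow\,\trianglerighteq$ if either (i) for some $a\succ b$: $\succsim_0=\succsim\ominus(a,b)$, not $a\vartriangleright b$, and $x\succ b$ for every $x$ with $x\vartriangleright b$; or (ii) for some distinct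 $a,b$ with $(a,b)\in\mathrm{Inc}(\succ)$: $\succsim\oplus(a,b)$ is defined, equals $\succsim_0$, and $a\vartriangleright b$. $\succsim_*$ is in-between $\succsim$ and $\trianglerighteq$ if there are $n\ge1$ and $\succsim_0,\dots,\succsim_{n-1}\in\mathbb{A}(X)$ with $\succsim_{n-1}=\succsim_*$, $\succsim\rightarrow\succsim_0\twoheadrightarrow\trianglerighteq$, and $\succsim_{k-1}\rightarrow\succsim_k\twoheadrightarrow\trianglerighteq$ for $k=1,\dots,n-1$. For distinct $a,b\in X$, $\succsim_{ab}$ is the partial order $\Delta_X\cup\big((X\setminus\{a,b\})\times\{a,b\}\big)$ (where $\Delta_X$ is the diagonal) and $\succsim_{ab}^+:=\succsim_{ab}\cup\{(a,b)\}$. For $b\in X$ and $\succsim\in\mathbb{A}(X)$, $N(b,\succsim)$ is the number of $x\in X\setminus\{b\}$ such that not $x\succ b$. A semimetric on a set $Z$ is a map $d:Z\times Z\to[0,\infty)$ with $d(z,z)=0$, symmetric, and satisfying the triangle inequality (distinct points may have distance $0$). *)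

theory Defs
  imports Complex_Main
begin

text \<open>
  The ground set is an explicit carrier \<open>X\<close>. A weak relation \<open>x \<succsim> y\<close> on \<open>X\<close> is
  \<^term>\<open>(x, y) \<in> r\<close> with \<^term>\<open>r \<subseteq> X \<times> X\<close>. Throughout, \<open>r\<close> plays the role of \<open>\<succsim>\<close>
  and \<open>s\<close> the role of \<open>\<unrhd>\<close>.
\<close>

definition asym_part :: "'a rel \<Rightarrow> 'a rel" where
  "asym_part r = {(x, y). (x, y) \<in> r \<and> (y, x) \<notin> r}"

definition sym_part :: "'a rel \<Rightarrow> 'a rel" where
  "sym_part r = r - asym_part r"

definition incomp :: "'a set \<Rightarrow> 'a rel \<Rightarrow> 'a rel" where
  "incomp X r = {(x, y) \<in> X \<times> X. (x, y) \<notin> r \<and> (y, x) \<notin> r}"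

text \<open>
  Absence of a cycle \<open>z\<^sub>1, \<dots>, z\<^sub>k\<close> of pairwise distinct points is the same as the
  library notion \<^const>\<open>acyclic\<close>, which does not demand distinctness.
\<close>

lemma acyclic_iff_no_distinct_cycle:
  "acyclic q \<longleftrightarrow>
     \<not> (\<exists>zs. zs \<noteq> [] \<and> distinct zs \<and>
             (\<forall>i<length zs. (zs ! i, zs ! (Suc i mod length zs)) \<in> q))"
proof
  assume ac: "acyclic q"
  show "\<not> (\<exists>zs. zs \<noteq> [] \<and> distinct zs \<and>
             (\<forall>i<length zs. (zs ! i, zs ! (Suc i mod length zs)) \<in> q))"
  proof
    assume "\<exists>zs. zs \<noteq> [] \<and> distinct zs \<and>
             (\<forall>i<length zs. (zs ! i, zs ! (Suc i mod length zs)) \<in> q)"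
    then obtain zs where zs: "zs \<noteq> []"
      and step: "\<And>i. i < length zs \<Longrightarrow> (zs ! i, zs ! (Suc i mod length zs)) \<in> q"
      by blast
    let ?n = "length zs"
    let ?f = "\<lambda>i. zs ! (i mod ?n)"
    have "(?f 0, ?f ?n) \<in> q ^^ ?n"
      unfolding relpow_fun_conv
      using step by (intro exI[of _ ?f]) auto
    then have "(zs ! 0, zs ! 0) \<in> q ^^ ?n" by simp
    then have "(zs ! 0, zs ! 0) \<in> q\<^sup>+"
      using zs by (auto simp: trancl_power)
    then show False using ac by (auto simp: acyclic_def)
  qed
next
  assume none: "\<not> (\<exists>zs. zs \<noteq> [] \<and> distinct zs \<and>
             (\<forall>i<length zs. (zs ! i, zs ! (Suc i mod length zs)) \<in> q))"
  show "acyclic q"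
  proof (rule ccontr)
    let ?P = "\<lambda>n. 0 < n \<and> (\<exists>x. (x, x) \<in> q ^^ n)"
    assume "\<not> acyclic q"
    then obtain m where "?P m" by (auto simp: acyclic_def trancl_power)
    define n where "n = (LEAST n. ?P n)"
    have n: "?P n" unfolding n_def by (rule LeastI[of ?P]) fact
    have least: "\<not> ?P k" if "k < n" for k
      using that unfolding n_def by (rule not_less_Least)
    from n obtain x f where f: "f 0 = x" "f n = x" "\<And>i. i < n \<Longrightarrow> (f i, f (Suc i)) \<in> q"
      unfolding relpow_fun_conv by blast
    have ne: "f i \<noteq> f j" if "i < j" "j < n" for i j
    proof
      assume eq: "f i = f j"
      have "(f i, f j) \<in> q ^^ (j - i)"
        unfolding relpow_fun_conv
        using f(3) that by (intro exI[of _ "\<lambda>k. f (i + k)"]) auto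
      with eq have "?P (j - i)" using that by auto
      moreover have "j - i < n" using that by simp
      ultimately show False using least by blast
    qed
    let ?zs = "map f [0..<n]"
    have "distinct ?zs"
      using ne by (auto simp: distinct_map intro!: linorder_inj_onI)
    moreover have "(?zs ! i, ?zs ! (Suc i mod length ?zs)) \<in> q" if "i < length ?zs" for i
    proof (cases "Suc i = n")
      case True
      then show ?thesis using f(1,2) f(3)[of i] that by auto
    next
      case False
      then show ?thesis using f(3)[of i] that by auto
    qed
    moreover have "?zs \<noteq> []" using n by simp
    ultimately show False using none by blast
  qed
qed

definition acyclic_rel :: "'a rel \<Rightarrow> bool" where
  "acyclic_rel r \<longleftrightarrow> acyclic (asym_part r)"

definition acyclic_orders :: "'a set \<Rightarrow> 'a rel set" where
  "acyclic_orders X = {r. r \<subseteq> X \<times> X \<and> refl_on X r \<and> acyclic_rel r}"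

definition maxima :: "'a set \<Rightarrow> 'a rel \<Rightarrow> 'a set" where
  "maxima S r = {x \<in> S. \<not> (\<exists>y\<in>S. (y, x) \<in> asym_part r)}"

text \<open>The value is \<^const>\<open>None\<close> where \<open>r \<oplus> (a, b)\<close> is undefined.\<close>

definition oplus :: "'a set \<Rightarrow> 'a rel \<Rightarrow> 'a \<Rightarrow> 'a \<Rightarrow> 'a rel option" where
  "oplus X r a b =
     (if a \<noteq> b \<and> (a, b) \<in> incomp X r \<and> acyclic_rel (r \<union> {(a, b)})
        then Some (r \<union> {(a, b)})
      else if a \<noteq> b \<and> (a, b) \<in> sym_part r \<and> acyclic_rel (r - {(b, a)})
        then Some (r - {(b, a)})
      else None)"

text \<open>Only meaningful when \<^term>\<open>(a, b) \<in> asym_part r\<close>.\<close>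

definition ominus :: "'a rel \<Rightarrow> 'a \<Rightarrow> 'a \<Rightarrow> 'a rel" where
  "ominus r a b = r - {(a, b)}"

text \<open>
  \<open>step_towards X r r0 s\<close>: a single perturbation turns \<open>r\<close> into \<open>r0\<close>, and it is
  directed towards \<open>s\<close>.
\<close>

definition step_towards :: "'a set \<Rightarrow> 'a rel \<Rightarrow> 'a rel \<Rightarrow> 'a rel \<Rightarrow> bool" where
  "step_towards X r r0 s \<longleftrightarrow>
     (\<exists>a b. (a, b) \<in> asym_part r \<and> r0 = ominus r a b \<and> (a, b) \<notin> asym_part s \<and>
            (\<forall>x. (x, b) \<in> asym_part s \<longrightarrow> (x, b) \<in> asym_part r)) \<or>
     (\<exists>a b. a \<noteq> b \<and> (a, b) \<in> incomp X (asym_part r) \<and> oplus X r a b = Some r0 \<and>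
            (a, b) \<in> asym_part s)"

text \<open>\<open>in_between X t r s\<close>: the relation \<open>t\<close> is in-between \<open>r\<close> and \<open>s\<close>.\<close>

definition in_between :: "'a set \<Rightarrow> 'a rel \<Rightarrow> 'a rel \<Rightarrow> 'a rel \<Rightarrow> bool" where
  "in_between X t r s \<longleftrightarrow>
     (\<exists>n\<ge>1. \<exists>R :: nat \<Rightarrow> 'a rel.
        (\<forall>k<n. R k \<in> acyclic_orders X) \<and> R (n - 1) = t \<and>
        step_towards X r (R 0) s \<and>
        (\<forall>k\<in>{1..n - 1}. step_towards X (R (k - 1)) (R k) s))"

definition ord_ab :: "'a set \<Rightarrow> 'a \<Rightarrow> 'a \<Rightarrow> 'a rel" where
  "ord_ab X a b = Id_on X \<union> (X - {a, b}) \<times> {a, b}"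

definition ord_ab_plus :: "'a set \<Rightarrow> 'a \<Rightarrow> 'a \<Rightarrow> 'a rel" where
  "ord_ab_plus X a b = ord_ab X a b \<union> {(a, b)}"

definition num_not_above :: "'a set \<Rightarrow> 'a \<Rightarrow> 'a rel \<Rightarrow> nat" where
  "num_not_above X b r = card {x \<in> X - {b}. (x, b) \<notin> asym_part r}"

definition semimetric_on :: "'z set \<Rightarrow> ('z \<Rightarrow> 'z \<Rightarrow> real) \<Rightarrow> bool" where
  "semimetric_on Z d \<longleftrightarrow>
     (\<forall>x\<in>Z. \<forall>y\<in>Z. 0 \<le> d x y) \<and>
     (\<forall>x\<in>Z. d x x = 0) \<and>
     (\<forall>x\<in>Z. \<forall>y\<in>Z. d x y = d y x) \<and>
     (\<forall>x\<in>Z. \<forall>y\<in>Z. \<forall>z\<in>Z. d x z \<le> d x y + d y z)"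

definition top_difference :: "'a set \<Rightarrow> 'a rel \<Rightarrow> 'a rel \<Rightarrow> real" where
  "top_difference X r s = (\<Sum>S\<in>Pow X. real (card (sym_diff (maxima S r) (maxima S s))))"

definition axiom1 :: "'a set \<Rightarrow> ('a rel \<Rightarrow> 'a rel \<Rightarrow> real) \<Rightarrow> bool" where
  "axiom1 X d \<longleftrightarrow>
     (\<forall>r\<in>acyclic_orders X. \<forall>r0\<in>acyclic_orders X. \<forall>s\<in>acyclic_orders X.
        in_between X r0 r s \<longrightarrow> d r s = d r r0 + d r0 s)"

definition axiom2 :: "'a set \<Rightarrow> ('a rel \<Rightarrow> 'a rel \<Rightarrow> real) \<Rightarrow> bool" where
  "axiom2 X d \<longleftrightarrow>
     (\<forall>a\<in>X. \<forall>b\<in>X. a \<noteq> b \<longrightarrow> d (ord_ab X a b) (ord_ab_plus X a b) = 1)"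

text \<open>
  The natural-number subtraction in the exponent does not truncate: in the first case
  \<open>a\<close> itself is counted by \<^term>\<open>num_not_above X b r\<close>.
\<close>

definition axiom3 :: "'a set \<Rightarrow> ('a rel \<Rightarrow> 'a rel \<Rightarrow> real) \<Rightarrow> bool" where
  "axiom3 X d \<longleftrightarrow>
     (\<forall>r\<in>acyclic_orders X. \<forall>a\<in>X. \<forall>b\<in>X. a \<noteq> b \<longrightarrow>
        ((a, b) \<notin> asym_part r \<and> (b, a) \<notin> asym_part r \<longrightarrow>
           (\<forall>r0. oplus X r a b = Some r0 \<longrightarrow>
              d r r0 = 2 ^ (num_not_above X b r - 1) * d (ord_ab X a b) (ord_ab_plus X a b))) \<and>
        ((a, b) \<in> asym_part r \<longrightarrow>
           d r (ominus r a b) =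
             2 ^ num_not_above X b r * d (ord_ab X a b) (ord_ab_plus X a b)))"

definition axiom4 :: "'a set \<Rightarrow> ('a rel \<Rightarrow> 'a rel \<Rightarrow> real) \<Rightarrow> bool" where
  "axiom4 X d \<longleftrightarrow>
     (\<forall>r\<in>acyclic_orders X. \<forall>s\<in>acyclic_orders X.
        asym_part r = asym_part s \<longrightarrow> d r s = 0)"

end

theory Submission
  imports Defs
begin

text \<open>
  The number \<open>D(r, s)\<close> is the size of the symmetric difference of the sets
  \<open>{(S, x). S \<subseteq> X, x \<in> M(S, r)}\<close>. A perturbation directed towards \<open>s\<close> produces a set lying
  between those of \<open>r\<close> and \<open>s\<close> in the sense of the Boolean metric, so \<open>D\<close> is additive along it,
  and its cost is a power of two. Conversely the axioms prescribe the same cost and the same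
  additivity, so it is enough to find a perturbation of \<open>r\<close> directed towards \<open>s\<close> whenever the
  asymmetric parts \<open>P\<close> of \<open>r\<close> and \<open>Q\<close> of \<open>s\<close> differ, and to induct on \<open>D(r, s)\<close>. If no pair can
  be removed, then every point whose sets of \<open>P\<close>- and \<open>Q\<close>-predecessors differ lacks some
  \<open>Q\<close>-predecessor in \<open>P\<close>; at a \<open>P\<close>-lowest such point \<open>b\<close> a missing pair \<open>(a, b)\<close> closes no cycle,
  because a \<open>P\<close>-path from \<open>b\<close> to \<open>a\<close> would also be a \<open>Q\<close>-path.
\<close>

section \<open>Top difference as a counting distance\<close>

definition max_graph :: "'a set \<Rightarrow> 'a rel \<Rightarrow> ('a set \<times> 'a) set" where
  "max_graph X r = (SIGMA S:Pow X. maxima S r)"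

lemma finite_max_graph:
  assumes "finite X"
  shows "finite (max_graph X r)"
proof (rule finite_subset)
  show "max_graph X r \<subseteq> Pow X \<times> X"
    by (auto simp: max_graph_def maxima_def)
qed (simp add: assms)

lemma top_difference_eq_card:
  assumes "finite X"
  shows "top_difference X r s = real (card (sym_diff (max_graph X r) (max_graph X s)))"
proof -
  have eq: "sym_diff (max_graph X r) (max_graph X s) =
      (SIGMA S:Pow X. sym_diff (maxima S r) (maxima S s))"
    by (auto simp: max_graph_def)
  have "finite (sym_diff (maxima S r) (maxima S s))" if "S \<in> Pow X" for S
    using that assms by (intro finite_subset[OF _ assms]) (auto simp: maxima_def)
  then show ?thesis
    unfolding top_difference_def eq using assms by (simp add: card_SigmaI)
qed

lemma top_difference_commute: "top_difference X r s = top_difference X s r"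
  by (simp add: top_difference_def Un_commute)

text \<open>No element changes membership twice on the way from \<open>A\<close> through
  \<open>C\<close> to \<open>B\<close>, so the two partial differences are disjoint.\<close>

lemma card_sym_diff_between:
  assumes "finite A" "finite B" "A \<inter> B \<subseteq> C" "C \<subseteq> A \<union> B"
  shows "card (sym_diff A B) = card (sym_diff A C) + card (sym_diff C B)"
proof -
  have "sym_diff A B = sym_diff A C \<union> sym_diff C B" "sym_diff A C \<inter> sym_diff C B = {}"
    using assms(3,4) by auto
  moreover have "finite C"
    using assms by (meson finite_UnI finite_subset)
  ultimately show ?thesis
    using assms(1,2) by (simp add: card_Un_disjoint)
qed

section \<open>Cost of a single perturbation\<close>

lemma top_difference_asym_cong:
  assumes "asym_part r = asym_part s"
  shows "top_difference X r s = 0"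
  using assms by (simp add: top_difference_def maxima_def)

text \<open>Only \<open>b\<close> can lose maximality, and only in sets that contain
  \<open>a\<close> and \<open>b\<close> and in which nothing was above \<open>b\<close>. Such a set
  is fixed by its remaining elements, an arbitrary subset of \<open>N - {a}\<close>.\<close>

lemma top_difference_insert:
  assumes "finite X" "a \<in> X" "b \<in> X" "a \<noteq> b" "(a, b) \<notin> asym_part r"
    and t: "asym_part t = insert (a, b) (asym_part r)"
  shows "top_difference X r t = 2 ^ (num_not_above X b r - 1)"
proof -
  define N where "N = {x \<in> X - {b}. (x, b) \<notin> asym_part r}"
  have irr: "(b, b) \<notin> asym_part r" by (simp add: asym_part_def)
  have fin: "finite N" and a: "a \<in> N" and b: "b \<notin> N"
    using assms by (auto simp: N_def)
  have "sym_diff (max_graph X r) (max_graph X t) =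
      (\<lambda>T. (insert a (insert b T), b)) ` Pow (N - {a})" (is "?L = ?R")
  proof
    show "?L \<subseteq> ?R"
    proof
      fix p assume "p \<in> ?L"
      then obtain S where p: "p = (S, b)" and S: "S \<subseteq> X" "a \<in> S" "b \<in> S"
        "\<forall>y\<in>S. (y, b) \<notin> asym_part r"
        by (auto simp: max_graph_def maxima_def t)
      then have "S - {a, b} \<in> Pow (N - {a})" "S = insert a (insert b (S - {a, b}))"
        by (auto simp: N_def)
      with p show "p \<in> ?R" by blast
    qed
    show "?R \<subseteq> ?L"
      using assms(2-5) irr by (auto simp: max_graph_def maxima_def t N_def)
  qed
  \<comment> \<open>\<open>T\<close> contains neither \<open>a\<close> nor \<open>b\<close>, so
    deleting both recovers it.\<close>
  moreover have "inj_on (\<lambda>T. (insert a (insert b T), b)) (Pow (N - {a}))"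
    using b by (intro inj_onI) blast
  ultimately have "card (sym_diff (max_graph X r) (max_graph X t)) = 2 ^ (card N - 1)"
    using fin a by (simp add: card_image card_Pow card_Diff_singleton)
  then show ?thesis
    using assms(1) by (simp add: top_difference_eq_card num_not_above_def N_def)
qed

text \<open>Reconciles the two exponents: a removal has its cost expressed by the count before the
  pair is deleted, which is one less than the count after.\<close>

lemma num_not_above_insert:
  assumes "finite X" "a \<in> X" "a \<noteq> b" "(a, b) \<notin> asym_part r"
    and t: "asym_part t = insert (a, b) (asym_part r)"
  shows "num_not_above X b r = Suc (num_not_above X b t)"
proof -
  have "{x \<in> X - {b}. (x, b) \<notin> asym_part r} = insert a {x \<in> X - {b}. (x, b) \<notin> asym_part t}"
    using assms by auto
  moreover have "a \<notin> {x \<in> X - {b}. (x, b) \<notin> asym_part t}" by (simp add: t)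
  ultimately show ?thesis
    using assms(1) by (simp add: num_not_above_def)
qed

lemma asym_part_ominus:
  assumes "(a, b) \<in> asym_part r"
  shows "asym_part (ominus r a b) = asym_part r - {(a, b)}"
  using assms by (auto simp: asym_part_def ominus_def)

lemma asym_part_oplus:
  assumes "oplus X r a b = Some t"
  shows "asym_part t = insert (a, b) (asym_part r)"
  using assms
  by (auto simp: oplus_def asym_part_def incomp_def sym_part_def split: if_splits)

lemma ominus_acyclic_order:
  assumes r: "r \<in> acyclic_orders X" and ab: "(a, b) \<in> asym_part r"
  shows "ominus r a b \<in> acyclic_orders X"
proof -
  have "acyclic (asym_part (ominus r a b))"
    using r by (auto simp: asym_part_ominus[OF ab] acyclic_orders_def acyclic_rel_def
        intro: acyclic_subset)
  moreover have "a \<noteq> b" using ab by (auto simp: asym_part_def)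
  ultimately show ?thesis
    using r by (auto simp: acyclic_orders_def acyclic_rel_def ominus_def refl_on_def)
qed

lemma oplus_acyclic_order:
  assumes "r \<in> acyclic_orders X" "oplus X r a b = Some t"
  shows "t \<in> acyclic_orders X"
  using assms
  by (auto simp: oplus_def acyclic_orders_def refl_on_def incomp_def split: if_splits)

text \<open>When neither pair is strict, \<open>a\<close> and \<open>b\<close> are tied or
  incomparable, and both clauses of \<open>oplus\<close> add exactly \<open>(a, b)\<close> to the
  asymmetric part.\<close>

lemma oplus_defined:
  assumes "a \<in> X" "b \<in> X" "a \<noteq> b" "(a, b) \<notin> asym_part r" "(b, a) \<notin> asym_part r"
    and ac: "acyclic (insert (a, b) (asym_part r))"
  shows "\<exists>t. oplus X r a b = Some t"
proof (cases "(a, b) \<in> r")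
  case True
  then have "(b, a) \<in> r" using assms(4) by (auto simp: asym_part_def)
  moreover from this True have "asym_part (r - {(b, a)}) = insert (a, b) (asym_part r)"
    using assms(3) by (auto simp: asym_part_def)
  ultimately show ?thesis
    using True assms by (auto simp: oplus_def incomp_def sym_part_def acyclic_rel_def)
next
  case False
  then have "(b, a) \<notin> r" using assms(5) by (auto simp: asym_part_def)
  moreover from this False have "asym_part (r \<union> {(a, b)}) = insert (a, b) (asym_part r)"
    using assms(3) by (auto simp: asym_part_def)
  ultimately show ?thesis
    using False assms by (auto simp: oplus_def incomp_def acyclic_rel_def)
qed

lemma top_difference_ominus:
  assumes "finite X" "a \<in> X" "b \<in> X" and ab: "(a, b) \<in> asym_part r"
  shows "top_difference X r (ominus r a b) = 2 ^ num_not_above X b r"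
proof -
  have ne: "a \<noteq> b" using ab by (auto simp: asym_part_def)
  \<comment> \<open>The removal is read backwards, as an insertion into the smaller
    relation.\<close>
  have eq: "asym_part r = insert (a, b) (asym_part (ominus r a b))"
    and nin: "(a, b) \<notin> asym_part (ominus r a b)"
    using ab by (auto simp: asym_part_ominus)
  show ?thesis
    using top_difference_insert[OF assms(1-3) ne nin eq]
      num_not_above_insert[OF assms(1,2) ne nin eq]
    by (simp add: top_difference_commute[of X r])
qed

lemma top_difference_oplus:
  assumes "finite X" "a \<in> X" "b \<in> X" "a \<noteq> b" "(a, b) \<notin> asym_part r"
    and "oplus X r a b = Some t"
  shows "top_difference X r t = 2 ^ (num_not_above X b r - 1)"
  using top_difference_insert[OF assms(1-5) asym_part_oplus[OF assms(6)]] .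

section \<open>Perturbations directed towards a target\<close>

lemma top_difference_step_towards:
  assumes "finite X" "step_towards X r t s"
  shows "top_difference X r s = top_difference X r t + top_difference X t s"
proof -
  have "max_graph X r \<inter> max_graph X s \<subseteq> max_graph X t \<and>
      max_graph X t \<subseteq> max_graph X r \<union> max_graph X s"
    using assms(2) unfolding step_towards_def
  proof (elim disjE exE conjE)
    fix a b
    assume ab: "(a, b) \<in> asym_part r" "t = ominus r a b" "(a, b) \<notin> asym_part s"
      and up: "\<forall>x. (x, b) \<in> asym_part s \<longrightarrow> (x, b) \<in> asym_part r"
    have t: "asym_part t = asym_part r - {(a, b)}"
      using ab by (simp add: asym_part_ominus)
    \<comment> \<open>If \<open>b\<close> becomes maximal in \<open>S\<close>, its only
      \<open>r\<close>-predecessor there was \<open>a\<close>. By \<open>up\<close> no other point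
      of \<open>S\<close> is above \<open>b\<close> in \<open>s\<close>, and \<open>a\<close> is not
      either, so \<open>b\<close> is \<open>s\<close>-maximal in \<open>S\<close>.\<close>
    show ?thesis
      using ab(3) up by (auto simp: max_graph_def maxima_def t)
  next
    fix a b
    assume "oplus X r a b = Some t" "(a, b) \<in> asym_part s"
    \<comment> \<open>Every set in which \<open>b\<close> stops being maximal contains
      \<open>a\<close>, so \<open>b\<close> is not \<open>s\<close>-maximal there.\<close>
    then show ?thesis
      by (auto simp: max_graph_def maxima_def asym_part_oplus)
  qed
  then show ?thesis
    using assms(1) card_sym_diff_between[of "max_graph X r" "max_graph X s" "max_graph X t"]
    by (simp add: top_difference_eq_card finite_max_graph)
qed

lemma step_towards_exists:
  assumes fin: "finite X" and r: "r \<in> acyclic_orders X" and s: "s \<in> acyclic_orders X"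
    and ne: "asym_part r \<noteq> asym_part s"
  shows "\<exists>t. step_towards X r t s \<and> t \<in> acyclic_orders X"
proof (cases "\<exists>a b. (a, b) \<in> asym_part r \<and> (a, b) \<notin> asym_part s \<and>
    (\<forall>x. (x, b) \<in> asym_part s \<longrightarrow> (x, b) \<in> asym_part r)")
  case True
  then show ?thesis
    using ominus_acyclic_order[OF r] unfolding step_towards_def by blast
next
  case False
  define P where "P = asym_part r"
  define Q where "Q = asym_part s"
  define B where "B = {b. \<exists>x. (x, b) \<in> P \<longleftrightarrow> (x, b) \<notin> Q}"
  have sub: "P \<subseteq> X \<times> X" "Q \<subseteq> X \<times> X"
    using r s by (auto simp: P_def Q_def acyclic_orders_def asym_part_def)
  have acP: "acyclic P" and acQ: "acyclic Q"
    using r s by (auto simp: P_def Q_def acyclic_orders_def acyclic_rel_def)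
  \<comment> \<open>Otherwise the \<open>Q\<close>-predecessors of \<open>b\<close> form a proper
    subset of its \<open>P\<close>-predecessors, and a surplus pair could be removed.\<close>
  have missing: "\<exists>a. (a, b) \<in> Q \<and> (a, b) \<notin> P" if "b \<in> B" for b
    using False that unfolding B_def P_def Q_def by blast
  have "finite P"
    using sub(1) fin by (meson finite_SigmaI finite_subset)
  then have "wf (P\<inverse>)"
    using acP by (simp add: finite_acyclic_wf_converse)
  \<comment> \<open>Passing to the transitive closure makes the minimal \<open>b\<close> exclude
    from \<open>B\<close> all points reachable from it, not just its direct successors.\<close>
  then have "wf ((P\<inverse>)\<^sup>+)" by (rule wf_trancl)
  moreover from ne obtain b0 where "b0 \<in> B"
    unfolding B_def P_def Q_def by auto
  ultimately obtain b where b: "b \<in> B" and low: "\<And>c. (c, b) \<in> (P\<inverse>)\<^sup>+ \<Longrightarrow> c \<notin> B"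
    by (rule wfE_min) blast
  from missing[OF b] obtain a where a: "(a, b) \<in> Q" "(a, b) \<notin> P" by blast
  \<comment> \<open>Each edge of such a path ends outside \<open>B\<close>, where \<open>P\<close>-
    and \<open>Q\<close>-predecessors coincide.\<close>
  have path: "(b, c) \<in> Q\<^sup>+" if "(b, c) \<in> P\<^sup>+" for c
    using that
  proof (induction rule: trancl_induct)
    case (base c)
    then have "c \<notin> B" using low by blast
    with base show ?case unfolding B_def by blast
  next
    case (step c e)
    then have "(b, e) \<in> P\<^sup>+" by simp
    then have "e \<notin> B" using low by (simp add: trancl_converse)
    with step have "(c, e) \<in> Q" unfolding B_def by blast
    with step.IH show ?case by simp
  qed
  have nopath: "(b, a) \<notin> P\<^sup>+"
    using path a(1) acQ by (meson acyclic_def trancl_into_trancl)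
  have "a \<noteq> b" using a(1) acQ by (auto simp: acyclic_def)
  have "acyclic (insert (a, b) P)"
    using acP nopath \<open>a \<noteq> b\<close> by (auto simp: acyclic_insert rtrancl_eq_or_trancl)
  moreover have "(b, a) \<notin> P" using nopath by blast
  moreover have "a \<in> X" "b \<in> X" using a(1) sub by auto
  ultimately obtain t where t: "oplus X r a b = Some t"
    using oplus_defined[of a X b r] a(2) \<open>a \<noteq> b\<close> unfolding P_def by blast
  moreover have "(a, b) \<in> incomp X (asym_part r)"
    using \<open>a \<in> X\<close> \<open>b \<in> X\<close> a(2) \<open>(b, a) \<notin> P\<close> by (simp add: incomp_def P_def)
  ultimately have "step_towards X r t s"
    using \<open>a \<noteq> b\<close> a(1) unfolding step_towards_def Q_def by blast
  with oplus_acyclic_order[OF r t] show ?thesis by blast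
qed

section \<open>Chains of perturbations and the reference orders\<close>

lemma step_towards_in_between:
  assumes "step_towards X r t s" "t \<in> acyclic_orders X"
  shows "in_between X t r s"
  unfolding in_between_def using assms
  \<comment> \<open>With \<open>n = 1\<close> the index range \<open>{1..n - 1}\<close> is empty, so
    only the first step must be checked.\<close>
  by (intro exI[of _ 1] conjI exI[of _ "\<lambda>_. t"]) auto

lemma ord_ab_acyclic_order: "ord_ab X a b \<in> acyclic_orders X"
  if "a \<in> X" "b \<in> X"
proof -
  have "acyclic (asym_part (ord_ab X a b))"
    by (rule acyclicI_order[of _ "\<lambda>x. if x \<in> {a, b} then 0 else 1 :: nat"])
      (auto simp: asym_part_def ord_ab_def)
  then show ?thesis
    using that by (auto simp: acyclic_orders_def acyclic_rel_def ord_ab_def refl_on_def)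
qed

lemma ord_ab_plus_acyclic_order: "ord_ab_plus X a b \<in> acyclic_orders X"
  if "a \<in> X" "b \<in> X" "a \<noteq> b"
proof -
  have "acyclic (asym_part (ord_ab_plus X a b))"
    using that
    by (intro acyclicI_order[of _ "\<lambda>x. if x = b then 0 else if x = a then 1 else 2 :: nat"])
      (auto simp: asym_part_def ord_ab_plus_def ord_ab_def split: if_splits)
  then show ?thesis
    using that by (auto simp: acyclic_orders_def acyclic_rel_def ord_ab_plus_def ord_ab_def
        refl_on_def)
qed

lemma top_difference_ord_ab:
  assumes "finite X" "a \<in> X" "b \<in> X" "a \<noteq> b"
  shows "top_difference X (ord_ab X a b) (ord_ab_plus X a b) = 1"
proof -
  have "asym_part (ord_ab_plus X a b) = insert (a, b) (asym_part (ord_ab X a b))"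
    and nin: "(a, b) \<notin> asym_part (ord_ab X a b)"
    using assms by (auto simp: asym_part_def ord_ab_plus_def ord_ab_def)
  \<comment> \<open>Every other point lies above \<open>b\<close>, so the exponent is 0.\<close>
  moreover have "{x \<in> X - {b}. (x, b) \<notin> asym_part (ord_ab X a b)} = {a}"
    using assms by (auto simp: asym_part_def ord_ab_def)
  then have "num_not_above X b (ord_ab X a b) = 1"
    by (simp add: num_not_above_def)
  ultimately show ?thesis
    using top_difference_insert[OF assms nin] by simp
qed

lemma additive_along_in_between:
  assumes d: "semimetric_on (acyclic_orders X) d"
    and step: "\<And>r t. r \<in> acyclic_orders X \<Longrightarrow> t \<in> acyclic_orders X \<Longrightarrow>
      step_towards X r t s \<Longrightarrow> d r s = d r t + d t s"
    and r: "r \<in> acyclic_orders X" and s: "s \<in> acyclic_orders X"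
    and t: "in_between X t r s"
  shows "d r s = d r t + d t s"
proof -
  from t obtain n and R :: "nat \<Rightarrow> 'a rel" where n: "n \<ge> 1" and R: "R (n - 1) = t"
    and ao: "\<And>k. k < n \<Longrightarrow> R k \<in> acyclic_orders X"
    and first: "step_towards X r (R 0) s"
    and further: "\<And>k. k \<in> {1..n - 1} \<Longrightarrow> step_towards X (R (k - 1)) (R k) s"
    unfolding in_between_def by blast
  have tri: "d x z \<le> d x y + d y z"
    if "x \<in> acyclic_orders X" "y \<in> acyclic_orders X" "z \<in> acyclic_orders X" for x y z
    using d that unfolding semimetric_on_def by blast
  have "d r s = d r (R k) + d (R k) s" if "k < n" for k
    using that
  proof (induction k)
    case 0
    then show ?case using step[OF r ao first] by simp
  next
    case (Suc k)
    have "d (R k) s = d (R k) (R (Suc k)) + d (R (Suc k)) s"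
      using step[OF ao ao] further[of "Suc k"] Suc.prems by simp
    moreover have "d r s = d r (R k) + d (R k) s"
      using Suc by simp
    \<comment> \<open>The two equations and the triangle inequality from \<open>r\<close> to
      \<open>R (Suc k)\<close> give one inequality; the triangle inequality from \<open>r\<close> to
      \<open>s\<close> gives the other.\<close>
    ultimately show ?case
      using tri[OF r ao s, of "Suc k"] tri[OF r ao ao, of k "Suc k"] Suc.prems by simp
  qed
  from this[of "n - 1"] show ?thesis using n R by simp
qed

section \<open>The axioms determine the distance\<close>

lemma axioms_step_cost:
  assumes fin: "finite X" and ax2: "axiom2 X d" and ax3: "axiom3 X d"
    and r: "r \<in> acyclic_orders X" and step: "step_towards X r t s"
  shows "d r t = top_difference X r t \<and> top_difference X r t > 0"
  using step unfolding step_towards_def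
proof (elim disjE exE conjE)
  fix a b
  assume ab: "(a, b) \<in> asym_part r" and t: "t = ominus r a b"
  then have "a \<in> X" "b \<in> X" "a \<noteq> b"
    using r by (auto simp: acyclic_orders_def asym_part_def)
  \<comment> \<open>Axiom 3 expresses the cost through the reference pair, whose distance Axiom 2
    sets to 1.\<close>
  moreover from this have "d r t = 2 ^ num_not_above X b r"
    using ax2 ax3 r ab unfolding t axiom2_def axiom3_def by auto
  ultimately show ?thesis
    using top_difference_ominus[OF fin _ _ ab] t by simp
next
  fix a b
  assume ab: "a \<noteq> b" "(a, b) \<in> incomp X (asym_part r)" and t: "oplus X r a b = Some t"
  then have "a \<in> X" "b \<in> X" "(a, b) \<notin> asym_part r" "(b, a) \<notin> asym_part r"
    by (auto simp: incomp_def)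
  moreover from this have "d r t = 2 ^ (num_not_above X b r - 1)"
    using ax2 ax3 r ab t unfolding axiom2_def axiom3_def by auto
  ultimately show ?thesis
    using top_difference_oplus[OF fin _ _ ab(1) _ t] by simp
qed

lemma axioms_imp_top_difference:
  assumes fin: "finite X"
    and ax: "axiom1 X d" "axiom2 X d" "axiom3 X d" "axiom4 X d"
    and s: "s \<in> acyclic_orders X" and "r \<in> acyclic_orders X"
  shows "d r s = top_difference X r s"
  using assms(7)
\<comment> \<open>The measure is the natural number behind the real-valued
  \<open>top_difference\<close>; it drops because every step has positive cost.\<close>
proof (induction "card (sym_diff (max_graph X r) (max_graph X s))" arbitrary: r rule: less_induct)
  case less
  note r = \<open>r \<in> acyclic_orders X\<close>
  show ?case
  proof (cases "asym_part r = asym_part s")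
    case True
    then show ?thesis
      using ax(4) r s by (simp add: axiom4_def top_difference_asym_cong)
  next
    case False
    from step_towards_exists[OF fin r s False] obtain t
      where step: "step_towards X r t s" and t: "t \<in> acyclic_orders X" by blast
    note add = top_difference_step_towards[OF fin step]
    note cost = axioms_step_cost[OF fin ax(2,3) r step]
    have "top_difference X t s < top_difference X r s"
      using add cost by simp
    then have "d t s = top_difference X t s"
      using less.hyps[OF _ t] by (simp add: top_difference_eq_card[OF fin])
    moreover have "d r s = d r t + d t s"
      using ax(1) r s t step_towards_in_between[OF step t] unfolding axiom1_def by blast
    ultimately show ?thesis using add cost by simp
  qed
qed

theorem theorem3p2:
  fixes X :: "'a set" and d :: "'a rel \<Rightarrow> 'a rel \<Rightarrow> real"
  assumes "finite X" and "X \<noteq> {}"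
    and "semimetric_on (acyclic_orders X) d"
  shows "(axiom1 X d \<and> axiom2 X d \<and> axiom3 X d \<and> axiom4 X d) \<longleftrightarrow>
         (\<forall>r\<in>acyclic_orders X. \<forall>s\<in>acyclic_orders X. d r s = top_difference X r s)"
proof (intro iffI ballI conjI)
  fix r s
  assume "axiom1 X d \<and> axiom2 X d \<and> axiom3 X d \<and> axiom4 X d"
    and "r \<in> acyclic_orders X" "s \<in> acyclic_orders X"
  then show "d r s = top_difference X r s"
    using axioms_imp_top_difference[OF assms(1)] by blast
next
  assume "\<forall>r\<in>acyclic_orders X. \<forall>s\<in>acyclic_orders X. d r s = top_difference X r s"
  then have D: "d r s = top_difference X r s"
    if "r \<in> acyclic_orders X" "s \<in> acyclic_orders X" for r s
    using that by blast
  \<comment> \<open>\<open>top_difference\<close> is additive along single steps; the semimetric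
    hypothesis on \<open>d\<close> supplies the triangle inequality that extends this to
    chains.\<close>
  have "d r s = d r t + d t s"
    if "r \<in> acyclic_orders X" "s \<in> acyclic_orders X" "in_between X t r s" for r s t
  proof (rule additive_along_in_between[OF assms(3) _ that])
    fix q t assume "q \<in> acyclic_orders X" "t \<in> acyclic_orders X" "step_towards X q t s"
    then show "d q s = d q t + d t s"
      using top_difference_step_towards[OF assms(1)] D that(2) by simp
  qed
  then show "axiom1 X d" unfolding axiom1_def by blast
  have unit: "d (ord_ab X a b) (ord_ab_plus X a b) = 1" if "a \<in> X" "b \<in> X" "a \<noteq> b" for a b
    using that assms(1)
    by (simp add: D ord_ab_acyclic_order ord_ab_plus_acyclic_order top_difference_ord_ab)
  then show "axiom2 X d" unfolding axiom2_def by blast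
  show "axiom3 X d"
    unfolding axiom3_def
    using unit assms(1)
    by (auto simp: D oplus_acyclic_order ominus_acyclic_order top_difference_ominus
        top_difference_oplus)
  show "axiom4 X d"
    unfolding axiom4_def using D top_difference_asym_cong by metis
qed

end
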